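(* Let $\dot{G}=(G,\sigma)$ be an unbalanced signed graph of order $n$, and let $k$ be an integer with $3 \le k \le n/10-1$. If $\dot{G}$ is $C_{2k+1}^{-}$-free, then $$e(\dot{G}) \le \frac{n(n-1)}{2}-2(n-3),$$ with equality if and only if $\dot{G}$ is switching equivalent to $C_{3}^{-} \cdot K_{n-2}$.
   Context: All graphs are finite, simple and undirected. A signed graph $\dot{G}=(G,\sigma)$ is a graph $G$ (the underlying graph) together with a sign function $\sigma:E(G)\to\{+1,-1\}$; $e(\dot{G})=|E(G)|$. The sign of a cycle is the product of the signs of its edges; a cycle is positive or negative accordingly, and $C_l^-$ denotes a negative cycle of length $l$. For $U\subseteq V(G)$, switching at $U$ reverses the sign of every edge between $U$ and $V(G)\setminus U$; two signed graphs are switching equivalent if one is obtained from the other by such a switching. A signed graph is balanced if it is switching equivalent to one with all edges positive (equivalently, every cycle is positive), and unbalanced otherwise. A signed graph is $C_{2k+1}^-$-free if it has no subgraph switching equivalent to $C_{2k+1}^-$ (i.e., it contains no negative cycle of length $2k+1$). $C_3^-\cdot K_{n-2}$ denotes the signed graph obtained from a negative triangle $C_3^-$ and an all-positive complete graph $(K_{n-2},+)$ by identifying one vertex of the triangle with one vertex of $K_{n-2}$. *)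

theory Defs
  imports Complex_Main
begin

text \<open>
  The values of \<open>sign\<close> off the edge set carry no information; isomorphism
  compares signs on edges only.
\<close>

record 'a sgraph =
  verts :: "'a set"
  edges :: "'a set set"
  sign :: "'a set \<Rightarrow> int"

definition signed_graph :: "'a sgraph \<Rightarrow> bool" where
  "signed_graph G \<longleftrightarrow>
     finite (verts G) \<and>
     edges G \<subseteq> {e. e \<subseteq> verts G \<and> card e = 2} \<and>
     (\<forall>e\<in>edges G. sign G e \<in> {1, -1})"

definition subgraph :: "'a sgraph \<Rightarrow> 'a sgraph \<Rightarrow> bool" where
  "subgraph H G \<longleftrightarrow>
     signed_graph H \<and> verts H \<subseteq> verts G \<and> edges H \<subseteq> edges G \<and>
     (\<forall>e\<in>edges H. sign H e = sign G e)"

definition isomorphic :: "'a sgraph \<Rightarrow> 'b sgraph \<Rightarrow> bool" where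
  "isomorphic G H \<longleftrightarrow>
     (\<exists>f. bij_betw f (verts G) (verts H) \<and>
          edges H = (\<lambda>e. f ` e) ` edges G \<and>
          (\<forall>e\<in>edges G. sign H (f ` e) = sign G e))"

definition switch :: "'a set \<Rightarrow> 'a sgraph \<Rightarrow> 'a sgraph" where
  "switch U G =
     G\<lparr>sign := (\<lambda>e. if e \<inter> U \<noteq> {} \<and> e \<inter> (verts G - U) \<noteq> {} then - sign G e else sign G e)\<rparr>"

text \<open>As usual, graphs are identified up to isomorphism here.\<close>

definition switching_equivalent :: "'a sgraph \<Rightarrow> 'b sgraph \<Rightarrow> bool" where
  "switching_equivalent G H \<longleftrightarrow> (\<exists>U\<subseteq>verts G. isomorphic (switch U G) H)"

definition balanced :: "'a sgraph \<Rightarrow> bool" where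
  "balanced G \<longleftrightarrow>
     (\<exists>H :: 'a sgraph. signed_graph H \<and> (\<forall>e\<in>edges H. sign H e = 1) \<and> switching_equivalent G H)"

definition cycle_edges :: "'a list \<Rightarrow> 'a set set" where
  "cycle_edges vs = {{vs ! i, vs ! (Suc i mod length vs)} | i. i < length vs}"

definition negative_cycle :: "nat \<Rightarrow> 'a sgraph \<Rightarrow> bool" where
  "negative_cycle l C \<longleftrightarrow>
     signed_graph C \<and>
     (\<exists>vs. length vs = l \<and> 3 \<le> l \<and> distinct vs \<and> verts C = set vs \<and> edges C = cycle_edges vs) \<and>
     (\<Prod>e\<in>edges C. sign C e) = -1"

definition negative_cycle_free :: "nat \<Rightarrow> 'a sgraph \<Rightarrow> bool" where
  "negative_cycle_free l G \<longleftrightarrow>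
     \<not> (\<exists>H (C :: 'a sgraph). subgraph H G \<and> negative_cycle l C \<and> switching_equivalent H C)"

text \<open>
  \<open>C\<^sub>3\<^sup>- \<cdot> K\<^sub>n\<^sub>-\<^sub>2\<close>: the complete graph lives on \<open>{2..<n}\<close>, the negative triangle on
  \<open>{0, 1, 2}\<close>, and the identified vertex is \<open>2\<close>. The choice of signs on the negative
  triangle is irrelevant up to switching. Meaningful for \<open>n \<ge> 3\<close>.
\<close>

definition neg_triangle_dot_complete :: "nat \<Rightarrow> nat sgraph" where
  "neg_triangle_dot_complete n =
     \<lparr>verts = {0..<n},
      edges = {{0, 1}, {0, 2}, {1, 2}} \<union> {e. e \<subseteq> {2..<n} \<and> card e = 2},
      sign = (\<lambda>e. if e = {0, 1} then -1 else 1)\<rparr>"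

end

theory Submission
  imports Defs
begin

text \<open>
  Suppose at most \<open>2n - 6\<close> edges are missing and put \<open>t = \<lfloor>n/5\<rfloor>\<close>. Choosing \<open>A \<subseteq> V\<close> to minimise
  (missing edges inside \<open>A\<close>) + \<open>t |V - A|\<close> gives a core in which every vertex misses at most \<open>t\<close>
  others, while every outside vertex misses at least \<open>t\<close> core vertices, and \<open>|V - A| \<le> 10\<close>.
  Inside \<open>A\<close> any two vertices are joined by paths of every relevant length. Swapping one vertex of
  a \<open>(2k+1)\<close>-cycle shows that all 4-cycles in \<open>A\<close> are positive; hence \<open>A\<close> is, up to switching,
  all positive or all negative, and the latter is impossible because \<open>2k+1\<close> is odd. A path of at
  most three vertices outside \<open>A\<close> with both ends attached to \<open>A\<close> closes to a \<open>(2k+1)\<close>-cycle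
  through \<open>A\<close>, so it is positive as well. If at most one outside vertex has fewer than two
  neighbours in \<open>A\<close>, this makes the whole graph balanced. Otherwise the missing edges at two such
  vertices already exhaust the budget \<open>2n - 6\<close>, which leaves only the extremal graph.
\<close>

section \<open>Signatures and switching\<close>

text \<open>
  A signed graph is encoded by a symmetric function \<open>s\<close> with values in \<open>{-1, 0, 1}\<close>, where \<open>0\<close>
  means non-adjacent; so a walk exists iff its \<open>walk_sign\<close> is non-zero.
\<close>

fun walk_sign :: "('a \<Rightarrow> 'a \<Rightarrow> int) \<Rightarrow> 'a list \<Rightarrow> int" where
  "walk_sign s (x # y # xs) = s x y * walk_sign s (y # xs)"
| "walk_sign s [x] = 1"
| "walk_sign s [] = 1"

definition signature :: "('a \<Rightarrow> 'a \<Rightarrow> int) \<Rightarrow> bool" where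
  "signature s \<longleftrightarrow> (\<forall>u v. s u v = s v u) \<and> (\<forall>u v. s u v \<in> {-1, 0, 1}) \<and> (\<forall>u. s u u = 0)"

text \<open>A list that uses a non-adjacent pair has product \<open>0\<close>, so only genuine
  cycles are constrained.\<close>

definition no_neg_cycle :: "nat \<Rightarrow> 'a set \<Rightarrow> ('a \<Rightarrow> 'a \<Rightarrow> int) \<Rightarrow> bool" where
  "no_neg_cycle l V s \<longleftrightarrow>
     (\<forall>vs. distinct vs \<and> set vs \<subseteq> V \<and> length vs = l \<longrightarrow> walk_sign s vs * s (last vs) (hd vs) \<noteq> -1)"

text \<open>For a \<open>signing\<close> \<open>e\<close> this is switching at the set where
  \<open>e\<close> is \<open>-1\<close>; in this multiplicative form switchings compose by pointwise
  product.\<close>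

definition switched :: "('a \<Rightarrow> int) \<Rightarrow> ('a \<Rightarrow> 'a \<Rightarrow> int) \<Rightarrow> 'a \<Rightarrow> 'a \<Rightarrow> int" where
  "switched e s = (\<lambda>u v. e u * e v * s u v)"

definition signing :: "('a \<Rightarrow> int) \<Rightarrow> bool" where
  "signing e \<longleftrightarrow> (\<forall>v. e v \<in> {1, -1})"

definition balanced_on :: "'a set \<Rightarrow> ('a \<Rightarrow> 'a \<Rightarrow> int) \<Rightarrow> bool" where
  "balanced_on A s \<longleftrightarrow> (\<exists>e. signing e \<and> (\<forall>u\<in>A. \<forall>v\<in>A. switched e s u v \<ge> 0))"

definition non_nbrs :: "('a \<Rightarrow> 'a \<Rightarrow> int) \<Rightarrow> 'a set \<Rightarrow> 'a \<Rightarrow> nat" where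
  "non_nbrs s A v = card {u \<in> A. u \<noteq> v \<and> s u v = 0}"

text \<open>Counts ordered pairs, i.e. every missing edge twice.\<close>

definition non_edges :: "('a \<Rightarrow> 'a \<Rightarrow> int) \<Rightarrow> 'a set \<Rightarrow> nat" where
  "non_edges s A = card {(u, v). u \<in> A \<and> v \<in> A \<and> u \<noteq> v \<and> s u v = 0}"

lemma signature_values: "signature s \<Longrightarrow> s u v = -1 \<or> s u v = 0 \<or> s u v = 1"
  unfolding signature_def by blast

lemma signature_sym: "signature s \<Longrightarrow> s u v = s v u"
  unfolding signature_def by blast

lemma signature_irrefl: "signature s \<Longrightarrow> s u u = 0"
  unfolding signature_def by blast

lemma signing_values: "signing e \<Longrightarrow> e v = 1 \<or> e v = -1"
  unfolding signing_def by blast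

lemma signing_square: "signing e \<Longrightarrow> e v * e v = 1"
  using signing_values[of e v] by auto

lemma walk_sign_append:
  "xs \<noteq> [] \<Longrightarrow> ys \<noteq> [] \<Longrightarrow>
     walk_sign s (xs @ ys) = walk_sign s xs * s (last xs) (hd ys) * walk_sign s ys"
proof (induction s xs rule: walk_sign.induct)
  case (2 s x)
  then show ?case by (cases ys) auto
qed auto

lemma walk_sign_values: "signature s \<Longrightarrow> walk_sign s vs \<in> {-1, 0, 1}"
proof (induction s vs rule: walk_sign.induct)
  case (1 s x y xs)
  then show ?case using signature_values[of s x y] by auto
qed auto

lemma switched_switched: "switched e (switched f s) = switched (\<lambda>v. e v * f v) s"
  by (simp add: switched_def fun_eq_iff algebra_simps)

lemma signing_mult:
  assumes "signing e" "signing f"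
  shows "signing (\<lambda>v. e v * f v)"
proof -
  have "e v * f v \<in> {1, -1}" for v
    using signing_values[OF assms(1), of v] signing_values[OF assms(2), of v] by auto
  then show ?thesis unfolding signing_def by blast
qed

lemma balanced_on_switchedD:
  assumes "signing e" "balanced_on A (switched e s)"
  shows "balanced_on A s"
proof -
  obtain f where "signing f" "\<forall>u\<in>A. \<forall>v\<in>A. switched f (switched e s) u v \<ge> 0"
    using assms(2) unfolding balanced_on_def by blast
  then show ?thesis
    unfolding balanced_on_def switched_switched using signing_mult[OF _ assms(1)] by blast
qed

lemma signature_switched:
  assumes "signing e" "signature s"
  shows "signature (switched e s)"
proof -
  have "switched e s u v \<in> {-1, 0, 1}" for u v
    using signing_values[OF assms(1), of u] signing_values[OF assms(1), of v]
      signature_values[OF assms(2), of u v] by (auto simp: switched_def)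
  then show ?thesis
    using signature_sym[OF assms(2)] signature_irrefl[OF assms(2)]
    unfolding signature_def switched_def by (simp add: mult.commute)
qed

lemma switched_eq_0_iff: "signing e \<Longrightarrow> switched e s u v = 0 \<longleftrightarrow> s u v = 0"
  using signing_values[of e u] signing_values[of e v] by (auto simp: switched_def)

text \<open>Each interior vertex lies on two consecutive edges, so its factor is squared away and
  only the two ends survive; closing the walk cancels these too.\<close>

lemma walk_sign_switched:
  assumes "signing e" "vs \<noteq> []"
  shows "walk_sign (switched e s) vs = e (hd vs) * e (last vs) * walk_sign s vs"
  using assms(2)
proof (induction s vs rule: walk_sign.induct)
  case (1 s x y xs)
  have "walk_sign (switched e s) (x # y # xs) =
      (e y * e y) * (e x * e (last (y # xs)) * (s x y * walk_sign s (y # xs)))"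
    using 1 by (simp add: switched_def algebra_simps)
  then show ?case
    using signing_square[OF assms(1), of y] by simp
qed (use signing_square[OF assms(1)] in auto)

lemma no_neg_cycle_switched:
  assumes "signing e" "no_neg_cycle l V s" "l > 0"
  shows "no_neg_cycle l V (switched e s)"
  unfolding no_neg_cycle_def
proof (intro allI impI)
  fix vs assume vs: "distinct vs \<and> set vs \<subseteq> V \<and> length vs = l"
  then have "vs \<noteq> []" using assms(3) by auto
  then have "walk_sign (switched e s) vs * switched e s (last vs) (hd vs) =
      (e (hd vs) * e (hd vs)) * (e (last vs) * e (last vs)) * (walk_sign s vs * s (last vs) (hd vs))"
    using walk_sign_switched[OF assms(1), of vs s] by (simp add: switched_def algebra_simps)
  then show "walk_sign (switched e s) vs * switched e s (last vs) (hd vs) \<noteq> -1"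
    using assms(2) vs signing_square[OF assms(1)] unfolding no_neg_cycle_def by simp
qed

lemma non_nbrs_switched: "signing e \<Longrightarrow> non_nbrs (switched e s) A v = non_nbrs s A v"
  by (simp add: non_nbrs_def switched_eq_0_iff)

lemma non_edges_switched: "signing e \<Longrightarrow> non_edges (switched e s) A = non_edges s A"
  by (simp add: non_edges_def switched_eq_0_iff)

section \<open>Counting missing edges\<close>

lemma finite_non_edges:
  "finite A \<Longrightarrow> finite {(u, v). u \<in> A \<and> v \<in> A \<and> u \<noteq> v \<and> s u v = (0::int)}"
  by (rule finite_subset[of _ "A \<times> A"]) auto

lemma non_edges_insert:
  assumes "finite A" "b \<notin> A" "signature s"
  shows "non_edges s (insert b A) = non_edges s A + 2 * non_nbrs s A b"
proof -
  let ?Z = "{u \<in> A. u \<noteq> b \<and> s u b = 0}"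
  let ?N = "\<lambda>A. {(u, v). u \<in> A \<and> v \<in> A \<and> u \<noteq> v \<and> s u v = 0}"
  have "?N (insert b A) = ?N A \<union> ((\<lambda>u. (u, b)) ` ?Z \<union> (\<lambda>u. (b, u)) ` ?Z)"
    using assms(2) signature_sym[OF assms(3)] by (auto simp: image_iff)
  moreover have "card (?N A \<union> ((\<lambda>u. (u, b)) ` ?Z \<union> (\<lambda>u. (b, u)) ` ?Z)) =
      card (?N A) + card ((\<lambda>u. (u, b)) ` ?Z \<union> (\<lambda>u. (b, u)) ` ?Z)"
    using assms by (intro card_Un_disjoint finite_non_edges) auto
  moreover have "card ((\<lambda>u. (u, b)) ` ?Z \<union> (\<lambda>u. (b, u)) ` ?Z) =
      card ((\<lambda>u. (u, b)) ` ?Z) + card ((\<lambda>u. (b, u)) ` ?Z)"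
    using assms by (intro card_Un_disjoint) auto
  moreover have "card ((\<lambda>u. (u, b)) ` ?Z) = card ?Z" "card ((\<lambda>u. (b, u)) ` ?Z) = card ?Z"
    by (auto intro!: card_image inj_onI)
  ultimately show ?thesis by (simp add: non_edges_def non_nbrs_def)
qed

lemma non_nbrs_mono: "finite B \<Longrightarrow> A \<subseteq> B \<Longrightarrow> non_nbrs s A v \<le> non_nbrs s B v"
  unfolding non_nbrs_def by (intro card_mono) auto

text \<open>The vertices of \<open>B\<close> are added one at a time; only their missing pairs with
  \<open>A\<close> are kept, those inside \<open>B\<close> are discarded.\<close>

lemma non_edges_Un_ge:
  assumes "finite B" "finite A" "A \<inter> B = {}" "signature s"
  shows "non_edges s A + 2 * (\<Sum>b\<in>B. non_nbrs s A b) \<le> non_edges s (A \<union> B)"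
  using assms(1,3)
proof (induction B rule: finite_induct)
  case (insert b B)
  have "non_edges s (A \<union> insert b B) = non_edges s (A \<union> B) + 2 * non_nbrs s (A \<union> B) b"
    using non_edges_insert[of "A \<union> B" b s] insert assms by simp
  moreover have "non_nbrs s A b \<le> non_nbrs s (A \<union> B) b"
    using insert assms by (intro non_nbrs_mono) auto
  ultimately show ?case using insert by simp
qed simp

section \<open>The dense core\<close>

text \<open>Deleting \<open>v\<close> from a minimiser of \<open>f\<close> changes \<open>f\<close>
  by \<open>2 * t - 2 * non_nbrs s A v\<close>; adding \<open>b\<close> changes it by
  \<open>2 * non_nbrs s A b - 2 * t\<close>. Neither change can be negative. Comparison with
  \<open>V\<close> itself bounds the number of outside vertices.\<close>

lemma ex_core:
  assumes "finite V" "signature s"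
  obtains A where "A \<subseteq> V" "\<And>v. v \<in> A \<Longrightarrow> non_nbrs s A v \<le> t"
    "\<And>b. b \<in> V - A \<Longrightarrow> t \<le> non_nbrs s A b" "2 * t * card (V - A) \<le> non_edges s V"
proof -
  \<comment> \<open>The weight of an outside vertex is \<open>2 * t\<close> because
    \<open>non_edges\<close> counts ordered pairs.\<close>
  define f where "f A = non_edges s A + 2 * t * card (V - A)" for A
  obtain A where A: "A \<subseteq> V" and min: "\<And>B. B \<subseteq> V \<Longrightarrow> f A \<le> f B"
    using ex_has_least_nat[of "\<lambda>A. A \<subseteq> V" V f] by auto
  have fin: "finite A" using A assms finite_subset by blast
  show ?thesis
  proof
    show "A \<subseteq> V" by fact
    show "2 * t * card (V - A) \<le> non_edges s V"
      using min[of V] by (simp add: f_def)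
  next
    fix v assume v: "v \<in> A"
    have "non_edges s A = non_edges s (A - {v}) + 2 * non_nbrs s (A - {v}) v"
      using non_edges_insert[of "A - {v}" v s] fin v assms by (simp add: insert_absorb)
    moreover have "non_nbrs s (A - {v}) v = non_nbrs s A v"
      unfolding non_nbrs_def by (rule arg_cong[of _ _ card]) auto
    moreover have "card (V - (A - {v})) = card (V - A) + 1"
    proof -
      have "V - (A - {v}) = insert v (V - A)" using v A by auto
      then show ?thesis using v assms by simp
    qed
    moreover have "f A \<le> f (A - {v})" using A by (intro min) auto
    ultimately show "non_nbrs s A v \<le> t" by (simp add: f_def)
  next
    fix b assume b: "b \<in> V - A"
    have "card (V - A) = card (V - insert b A) + 1"
    proof -
      have "insert b (V - insert b A) = V - A" using b by auto
      moreover have "card (insert b (V - insert b A)) = card (V - insert b A) + 1"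
        using assms(1) by simp
      ultimately show ?thesis by (simp only:)
    qed
    moreover have "f A \<le> f (insert b A)" using A b by (intro min) auto
    ultimately show "t \<le> non_nbrs s A b"
      using non_edges_insert[of A b s] fin b assms by (simp add: f_def)
  qed
qed

text \<open>\<open>room\<close> leaves space for core paths that complete a cycle of length
  \<open>2 * k + 1\<close> and avoid up to two further vertices; \<open>room3\<close> gives any
  three core vertices a common neighbour.\<close>

locale dense_core =
  fixes V A :: "'a set" and s :: "'a \<Rightarrow> 'a \<Rightarrow> int" and t k :: nat
  assumes sig: "signature s"
    and fin: "finite V" and sub: "A \<subseteq> V"
    and nbrs: "\<And>v. v \<in> A \<Longrightarrow> non_nbrs s A v \<le> t"
    and room: "2 * t + 2 * k + 8 \<le> card A" and room3: "3 * (t + 1) < card A"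
    and k3: "3 \<le> k"
    and free: "no_neg_cycle (2 * k + 1) V s"
begin

lemmas vals = signature_values[OF sig]
lemmas sym = signature_sym[OF sig]
lemmas irrefl = signature_irrefl[OF sig]

lemma finA: "finite A"
  using fin sub finite_subset by blast

lemma dense_core_switched: "signing e \<Longrightarrow> dense_core V A (switched e s) t k"
  using fin sub nbrs room room3 k3 signature_switched[OF _ sig] no_neg_cycle_switched[OF _ free]
  by (unfold_locales) (auto simp: non_nbrs_switched)

section \<open>Common neighbours and paths in the core\<close>

text \<open>Each vertex of \<open>U\<close> rules out at most \<open>t + 1\<close> candidates: its
  non-neighbours in \<open>A\<close> and itself.\<close>

lemma ex_common_nbr:
  assumes "U \<subseteq> A" "finite X" "card X + card U * (t + 1) < card A"
  shows "\<exists>w. w \<in> A \<and> w \<notin> X \<and> (\<forall>u\<in>U. s u w \<noteq> 0 \<and> s w u \<noteq> 0)"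
proof -
  define Z where "Z u = {w \<in> A. s w u = 0}" for u
  have finU: "finite U" using assms(1) finA finite_subset by blast
  have "card (Z u) \<le> t + 1" if "u \<in> A" for u
  proof -
    have "Z u = insert u {w \<in> A. w \<noteq> u \<and> s w u = 0}"
      using that irrefl by (auto simp: Z_def)
    then have "card (Z u) \<le> Suc (non_nbrs s A u)"
      using finA by (simp add: non_nbrs_def)
    then show ?thesis using nbrs[OF that] by simp
  qed
  then have "(\<Sum>u\<in>U. card (Z u)) \<le> (\<Sum>u\<in>U. t + 1)"
    using assms(1) by (intro sum_mono) auto
  moreover have "card (\<Union>u\<in>U. Z u) \<le> (\<Sum>u\<in>U. card (Z u))"
    using finU by (rule card_UN_le)
  moreover have "card (X \<union> (\<Union>u\<in>U. Z u)) \<le> card X + card (\<Union>u\<in>U. Z u)"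
    by (rule card_Un_le)
  ultimately have "card (X \<union> (\<Union>u\<in>U. Z u)) < card A"
    using assms(3) by simp
  moreover have "finite (X \<union> (\<Union>u\<in>U. Z u))"
    using assms(2) finU finA by (auto simp: Z_def)
  ultimately have "\<not> A \<subseteq> X \<union> (\<Union>u\<in>U. Z u)"
    using card_mono[of "X \<union> (\<Union>u\<in>U. Z u)" A] by linarith
  then obtain w where w: "w \<in> A" "w \<notin> X" "\<forall>u\<in>U. s w u \<noteq> 0"
    unfolding Z_def by blast
  then have "\<forall>u\<in>U. s u w \<noteq> 0 \<and> s w u \<noteq> 0" using sym[of _ w] by simp
  then show ?thesis using w by blast
qed

lemma ex_path:
  assumes "u \<in> A" "v \<in> A" "u \<noteq> v" "finite X" "u \<notin> X" "v \<notin> X" "1 \<le> j"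
    "2 * t + card X + j + 4 \<le> card A"
  shows "\<exists>Q. length Q = j \<and> distinct (u # Q @ [v]) \<and> set Q \<subseteq> A - X \<and> walk_sign s (u # Q @ [v]) \<noteq> 0"
  using assms(7,1,3-6,8)
proof (induction j arbitrary: u X rule: dec_induct)
  case base
  have "card {u, v} = 2" using base by simp
  then have "card X + card {u, v} * (t + 1) < card A" using base by simp
  then obtain w where w: "w \<in> A" "w \<notin> X" "s u w \<noteq> 0" "s w v \<noteq> 0"
    using ex_common_nbr[of "{u, v}" X] base assms(2) by auto
  then have "w \<noteq> u" "w \<noteq> v" using irrefl by auto
  then show ?case using base w by (intro exI[of _ "[w]"]) auto
next
  case (step j)
  have "card (insert v X) \<le> card X + 1" using step by (simp add: card_insert_if)
  then obtain w where w: "w \<in> A" "w \<notin> insert v X" "s u w \<noteq> 0"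
    using ex_common_nbr[of "{u}" "insert v X"] step by auto
  then have wu: "w \<noteq> u" using irrefl by auto
  have "card (insert u X) = card X + 1" using step by simp
  then have "\<exists>Q. length Q = j \<and> distinct (w # Q @ [v]) \<and> set Q \<subseteq> A - insert u X
      \<and> walk_sign s (w # Q @ [v]) \<noteq> 0"
    using w wu step by (intro step.IH) auto
  then obtain Q where "length Q = j" "distinct (w # Q @ [v])" "set Q \<subseteq> A - insert u X"
    "walk_sign s (w # Q @ [v]) \<noteq> 0" by blast
  then show ?case using w wu step by (intro exI[of _ "w # Q"]) auto
qed

section \<open>Signs inside the core\<close>

text \<open>A core path from \<open>v\<close> to \<open>u\<close> with \<open>2 * k - 2\<close>
  interior vertices avoiding \<open>w\<close> and \<open>w'\<close> closes through either of them to
  a cycle of length \<open>2 * k + 1\<close>. Neither cycle is negative, so both 2-paths have the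
  sign of that path.\<close>

lemma four_cycle_positive:
  assumes "u \<in> A" "v \<in> A" "u \<noteq> v" "w \<in> A" "w' \<in> A"
    and nz: "s u w \<noteq> 0" "s w v \<noteq> 0" "s u w' \<noteq> 0" "s w' v \<noteq> 0"
  shows "s u w * s w v = s u w' * s w' v"
proof -
  have ne: "w \<noteq> u" "w \<noteq> v" "w' \<noteq> u" "w' \<noteq> v" using nz irrefl by auto
  have "card {w, w'} \<le> 2" by (simp add: card_insert_if)
  then obtain Q where Q: "length Q = 2 * k - 2" "distinct (v # Q @ [u])" "set Q \<subseteq> A - {w, w'}"
    "walk_sign s (v # Q @ [u]) \<noteq> 0"
    using ex_path[of v u "{w, w'}" "2 * k - 2"] assms ne room k3 by fastforce
  let ?P = "walk_sign s (v # Q @ [u])"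
  have P: "?P = -1 \<or> ?P = 1"
    using walk_sign_values[OF sig, of "v # Q @ [u]"] Q(4) by auto
  have closed: "s u x * s x v = ?P" if "x \<in> {w, w'}" for x
  proof -
    have "distinct (x # v # Q @ [u])" "set (x # v # Q @ [u]) \<subseteq> V" "length (x # v # Q @ [u]) = 2 * k + 1"
      using Q ne assms that sub k3 by auto
    then have "walk_sign s (x # v # Q @ [u]) * s (last (x # v # Q @ [u])) (hd (x # v # Q @ [u])) \<noteq> -1"
      using free unfolding no_neg_cycle_def by blast
    then have "s x v * ?P * s u x \<noteq> -1" by simp
    moreover have "s u x = -1 \<or> s u x = 1" "s x v = -1 \<or> s x v = 1"
      using that nz vals[of u x] vals[of x v] by auto
    ultimately show ?thesis using P by (elim disjE) simp_all
  qed
  show ?thesis using closed[of w] closed[of w'] by simp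
qed

text \<open>
  Switching by the sign of any 2-path from a fixed root \<open>r\<close> makes all 2-paths positive, so that
  all edges of the core get the same sign.
\<close>

lemma core_balanced: "balanced_on A s"
proof -
  have "A \<noteq> {}" using room by auto
  then obtain r where r: "r \<in> A" by auto
  define P where "P u w \<longleftrightarrow> w \<in> A \<and> s r w \<noteq> 0 \<and> s w u \<noteq> 0" for u w
  have common: "\<exists>w. w \<in> A \<and> s u w \<noteq> 0 \<and> s v w \<noteq> 0 \<and> s x w \<noteq> 0" if "u \<in> A" "v \<in> A" "x \<in> A" for u v x
  proof -
    have "card {u, v, x} \<le> 3" by (simp add: card_insert_if)
    then have "card {u, v, x} * (t + 1) \<le> 3 * (t + 1)" by (rule mult_le_mono1)
    then have "card {} + card {u, v, x} * (t + 1) < card A" using room3 by simp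
    then show ?thesis using ex_common_nbr[of "{u, v, x}" "{}"] that by auto
  qed
  have "\<forall>u\<in>A. \<exists>w. P u w"
    unfolding P_def using common[OF r] sym by (metis (no_types))
  then obtain g where g: "\<And>u. u \<in> A \<Longrightarrow> P u (g u)" by metis
  define e where "e u = (if u \<in> A \<and> u \<noteq> r then s r (g u) * s (g u) u else 1)" for u
  \<comment> \<open>The sign of the 2-path does not depend on its middle vertex, by
    \<open>four_cycle_positive\<close>; at the root the default \<open>1\<close> agrees, since going
    out and back along an edge has sign \<open>1\<close>.\<close>
  have e: "e u = s r w * s w u" if "u \<in> A" "P u w" for u w
  proof (cases "u = r")
    case True
    then show ?thesis using that vals[of r w] sym[of w r] by (auto simp: e_def P_def)
  next
    case False
    then show ?thesis
      using that g[OF that(1)] four_cycle_positive[of r u w "g u"] r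
      by (auto simp: e_def P_def)
  qed
  have "signing e"
    unfolding signing_def
  proof
    fix u show "e u \<in> {1, -1}"
      using g[of u] vals[of r "g u"] vals[of "g u" u]
      by (auto simp: e_def P_def)
  qed
  define p where "p = switched e s"
  interpret p: dense_core V A p t k
    unfolding p_def by (rule dense_core_switched) fact
  have nz: "p u v = 0 \<longleftrightarrow> s u v = 0" for u v
    unfolding p_def using \<open>signing e\<close> by (rule switched_eq_0_iff)
  \<comment> \<open>Comparing 2-paths from \<open>r\<close> to \<open>u\<close> and \<open>v\<close>
    through a common neighbour \<open>x\<close>, and then replacing \<open>x\<close> by
    \<open>w\<close>, shows that \<open>e u * e v\<close> is the sign of the 2-path
    \<open>u, w, v\<close>. Hence this 2-path is positive in \<open>p\<close>.\<close>
  have star: "p u w = p v w" if h: "u \<in> A" "v \<in> A" "w \<in> A" "p u w \<noteq> 0" "p v w \<noteq> 0" for u v w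
  proof (cases "u = v")
    case False
    obtain x where x: "x \<in> A" "s r x \<noteq> 0" "s u x \<noteq> 0" "s v x \<noteq> 0"
      using common[OF r h(1,2)] by blast
    have "e u * e v = (s r x * s r x) * (s u x * s x v)"
      using e[of u x] e[of v x] x h sym[of u x] sym[of v x] by (simp add: P_def)
    also have "s r x * s r x = 1" using vals[of r x] x by auto
    also have "s u x * s x v = s u w * s w v"
      using four_cycle_positive[of u v x w] False x h sym[of v x] sym[of v w] by (simp add: nz)
    finally have "e u * e v = s u w * s v w" using sym[of v w] by simp
    then have "p u w * p v w = (e w * e w) * ((s u w * s u w) * (s v w * s v w))"
      by (simp add: p_def switched_def algebra_simps)
    moreover have "s u w * s u w = 1" "s v w * s v w = 1"
      using vals[of u w] vals[of v w] h by (auto simp: nz)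
    ultimately have "p u w * p v w = 1" using signing_square[OF \<open>signing e\<close>] by simp
    then show ?thesis using p.vals[of u w] p.vals[of v w] by auto
  qed simp
  \<comment> \<open>A common neighbour \<open>w\<close> of \<open>u\<close> and \<open>x\<close>
    gives the chain of edges \<open>uv\<close>, \<open>uw\<close>, \<open>xw\<close>,
    \<open>xy\<close>, in which consecutive edges share a vertex, so \<open>star\<close> applies
    three times.\<close>
  have const: "p u v = p x y" if h: "u \<in> A" "v \<in> A" "x \<in> A" "y \<in> A" "p u v \<noteq> 0" "p x y \<noteq> 0" for u v x y
  proof -
    obtain w where w: "w \<in> A" "p u w \<noteq> 0" "p x w \<noteq> 0"
      using common[OF h(1,1,3)] by (auto simp: nz)
    have "p v u = p w u" using star[of v w u] p.sym[of u v] p.sym[of u w] h w by simp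
    moreover have "p u w = p x w" using star h w by blast
    moreover have "p w x = p y x" using star[of w y x] p.sym[of x w] p.sym[of x y] h w by simp
    ultimately show ?thesis using p.sym[of u v] p.sym[of u w] p.sym[of x w] p.sym[of x y] by simp
  qed
  have "p x y \<ge> 0" if xy: "x \<in> A" "y \<in> A" for x y
  proof (rule ccontr)
    assume "\<not> p x y \<ge> 0"
    then have neg: "p x y = -1" using p.vals[of x y] by auto
    then have all_neg: "p u v = -1" if "u \<in> A" "v \<in> A" "p u v \<noteq> 0" for u v
      using const[of u v x y] that xy by simp
    have "x \<noteq> y" using neg p.irrefl by auto
    \<comment> \<open>If all core edges were negative, a path with \<open>2 * k\<close> edges would
      have sign \<open>1\<close> and its closing edge sign \<open>-1\<close>, giving a negative
      cycle of length \<open>2 * k + 1\<close>.\<close>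
    then obtain Q where Q: "length Q = 2 * k - 1" "distinct (x # Q @ [y])" "set Q \<subseteq> A - {}"
      "walk_sign p (x # Q @ [y]) \<noteq> 0"
      using p.ex_path[of x y "{}" "2 * k - 1"] xy room k3 by fastforce
    have "walk_sign p vs = (-1) ^ (length vs - 1)" if "walk_sign p vs \<noteq> 0" "set vs \<subseteq> A" for vs
      using that
    proof (induction vs)
      case (Cons a vs)
      show ?case
      proof (cases vs)
        case (Cons b ws)
        then have "p a b = -1" using Cons.prems all_neg[of a b] by auto
        then show ?thesis using Cons Cons.IH Cons.prems by auto
      qed simp
    qed simp
    then have "walk_sign p (x # Q @ [y]) = (-1) ^ (2 * k)"
      using Q xy k3 by force
    moreover have "walk_sign p (x # Q @ [y]) * p (last (x # Q @ [y])) (hd (x # Q @ [y])) \<noteq> -1"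
    proof -
      have "length (x # Q @ [y]) = 2 * k + 1" "set (x # Q @ [y]) \<subseteq> V"
        using Q xy k3 sub by auto
      then show ?thesis
        using p.free Q unfolding no_neg_cycle_def by blast
    qed
    ultimately show False using neg p.sym[of y x] by simp
  qed
  then show ?thesis
    using \<open>signing e\<close> unfolding balanced_on_def p_def by blast
qed

section \<open>Ears attached to the core\<close>

text \<open>A core path from \<open>a'\<close> to \<open>a\<close> with
  \<open>2 * k - 1 - length R\<close> interior vertices completes the ear to a cycle of length
  \<open>2 * k + 1\<close>. Core edges are positive, so the cycle has the sign of the ear. The
  bounds on \<open>length R\<close> and \<open>k\<close> leave at least one interior vertex.\<close>

lemma ear_positive:
  assumes pos: "\<And>u v. u \<in> A \<Longrightarrow> v \<in> A \<Longrightarrow> s u v \<ge> 0"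
    and R: "R \<noteq> []" "distinct R" "set R \<subseteq> V - A" "length R \<le> 3"
    and a: "a \<in> A" "a' \<in> A" "a \<noteq> a'"
  shows "s a (hd R) * walk_sign s R * s (last R) a' \<noteq> -1"
proof -
  have "1 \<le> 2 * k - 1 - length R" using R(4) k3 by linarith
  then obtain Q where Q: "length Q = 2 * k - 1 - length R" "distinct (a' # Q @ [a])" "set Q \<subseteq> A - {}"
    "walk_sign s (a' # Q @ [a]) \<noteq> 0"
    using ex_path[of a' a "{}" "2 * k - 1 - length R"] a room by fastforce
  have "walk_sign s vs \<in> {0, 1}" if "set vs \<subseteq> A" for vs
    using that
  proof (induction vs)
    case (Cons x vs)
    show ?case
    proof (cases vs)
      case (Cons y ys)
      then have "s x y = 0 \<or> s x y = 1" using Cons.prems pos[of x y] vals[of x y] by auto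
      then show ?thesis using Cons.IH Cons.prems Cons by auto
    qed simp
  qed simp
  from this[of "a' # Q @ [a]"] have Q1: "walk_sign s (a' # Q @ [a]) = 1"
    using Q a by auto
  let ?vs = "R @ (a' # Q @ [a])"
  have "distinct ?vs" "set ?vs \<subseteq> V" "length ?vs = 2 * k + 1"
    using Q R a sub k3 by auto
  then have "walk_sign s ?vs * s (last ?vs) (hd ?vs) \<noteq> -1"
    using free unfolding no_neg_cycle_def by blast
  moreover have "walk_sign s ?vs = walk_sign s R * s (last R) a' * walk_sign s (a' # Q @ [a])"
    using walk_sign_append[OF R(1), of "a' # Q @ [a]" s] by simp
  moreover have "last ?vs = a" "hd ?vs = hd R" using R(1) by auto
  ultimately show ?thesis using Q1 by (simp add: mult.commute mult.left_commute)
qed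

text \<open>Edges of both signs from one outside vertex to the core would form a negative one-vertex
  ear. So each outside vertex sends a single sign to the core, and switching those that send
  \<open>-1\<close> leaves the core itself unchanged.\<close>

lemma ex_switching_positive_at_core:
  assumes pos: "\<And>u v. u \<in> A \<Longrightarrow> v \<in> A \<Longrightarrow> s u v \<ge> 0"
  shows "\<exists>e. signing e \<and> (\<forall>u\<in>A. \<forall>v\<in>V. switched e s u v \<ge> 0)"
proof -
  define e :: "'a \<Rightarrow> int" where "e v = (if v \<in> V - A \<and> (\<exists>a\<in>A. s a v = -1) then -1 else 1)" for v
  have "signing e" by (simp add: signing_def e_def)
  moreover have "switched e s u v \<ge> 0" if uv: "u \<in> A" "v \<in> V" for u v
  proof (cases "v \<in> V - A \<and> (\<exists>a\<in>A. s a v = -1)")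
    case True
    then obtain a where a: "a \<in> A" "s a v = -1" by blast
    have "s u v \<noteq> 1"
    proof (cases "u = a")
      case False
      then have "s a v * walk_sign s [v] * s v u \<noteq> -1"
        using ear_positive[of "[v]" a u] True a uv pos by simp
      then show ?thesis using a sym[of u v] by simp
    qed (use a in simp)
    then have "s u v \<le> 0" using vals[of u v] by auto
    then show ?thesis using True uv by (simp add: switched_def e_def)
  next
    case False
    then have "s u v \<ge> 0" using uv pos[of u v] vals[of u v] by auto
    then show ?thesis using False uv by (simp add: switched_def e_def)
  qed
  ultimately show ?thesis by blast
qed

section \<open>Structure outside the core\<close>

text \<open>The budget is \<open>4 * card V - 12\<close> ordered missing pairs. Every outside vertex
  with at most one core neighbour uses at least \<open>2 * (card A - 1)\<close> of them, so at most
  two exist. Two of them exhaust the budget and force the structure; with at most one, positivity of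
  ears yields a balancing switch, a contradiction.\<close>

lemma extremal_structure:
  assumes pos: "\<And>u v. u \<in> A \<Longrightarrow> v \<in> V \<Longrightarrow> s u v \<ge> 0"
    and outer: "\<And>b. b \<in> V - A \<Longrightarrow> t \<le> non_nbrs s A b" and t: "3 \<le> t"
    and V: "card V \<le> card A + 10" "40 \<le> card V"
    and few: "non_edges s V + 12 \<le> 4 * card V"
    and unbal: "\<not> balanced_on V s"
  shows "\<exists>a b c. V = insert b (insert c A) \<and> a \<in> A \<and> b \<notin> A \<and> c \<notin> A \<and> b \<noteq> c
    \<and> s b c = -1 \<and> s a b = 1 \<and> s a c = 1
    \<and> (\<forall>u\<in>A. \<forall>v\<in>A. u \<noteq> v \<longrightarrow> s u v = 1) \<and> (\<forall>u\<in>A - {a}. s u b = 0 \<and> s u c = 0)"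
proof -
  define B where "B = V - A"
  define d where "d b = {a \<in> A. s a b \<noteq> 0}" for b
  define L where "L = {b \<in> B. card (d b) \<le> 1}"
  have finB: "finite B" using fin by (simp add: B_def)
  have cardV: "card V = card A + card B"
    using card_Un_disjoint[OF finA finB] sub by (simp add: B_def Un_absorb1)
  have d1: "s a b = 1" if "a \<in> d b" "b \<in> B" for a b
    using that pos[of a b] vals[of a b] by (auto simp: d_def B_def)
  have dA: "a \<in> A" if "a \<in> d b" for a b
    using that by (simp add: d_def)
  have find: "finite (d b)" for b using finA by (simp add: d_def)
  have degree: "non_nbrs s A b + card (d b) = card A" if "b \<in> B" for b
  proof -
    have "A = {u \<in> A. u \<noteq> b \<and> s u b = 0} \<union> d b" using that by (auto simp: d_def B_def)
    moreover have "card ({u \<in> A. u \<noteq> b \<and> s u b = 0} \<union> d b) = non_nbrs s A b + card (d b)"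
      unfolding non_nbrs_def using finA find by (intro card_Un_disjoint) (auto simp: d_def)
    ultimately show ?thesis by argo
  qed
  \<comment> \<open>An ear needs two distinct ends in the core; a vertex outside \<open>L\<close>
    can always avoid the end already chosen.\<close>
  have two: "\<exists>a'\<in>d b. a' \<noteq> a" if "b \<in> B - L" for a b
  proof (rule ccontr)
    assume "\<not> ?thesis"
    then have "d b \<subseteq> {a}" by auto
    then have "card (d b) \<le> card {a}" by (intro card_mono) auto
    then show False using that by (simp add: L_def)
  qed
  have posA: "s u v \<ge> 0" if "u \<in> A" "v \<in> A" for u v
    using that pos sub by blast
  \<comment> \<open>The ear \<open>x, b, c, y\<close> has positive outer edges, so its middle edge
    cannot be negative.\<close>
  have edge: "s b c \<ge> 0" if "b \<in> B" "c \<in> B" "x \<in> d b" "y \<in> d c" "x \<noteq> y" for b c x y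
  proof (cases "b = c")
    case False
    have "s x b * walk_sign s [b, c] * s c y \<noteq> -1"
      using ear_positive[OF posA, of "[b, c]" x y] False that dA by (auto simp: B_def)
    then show ?thesis using that d1 sym[of c y] vals[of b c] by auto
  qed (simp add: irrefl)
  have edge2: "s b c \<ge> 0" if "b \<in> B - L" "c \<in> B" "d c \<noteq> {}" for b c
    using two[OF that(1)] edge[of b c] that by blast
  have Lempty: "d b \<noteq> {}" if "b \<in> B - L" for b
    using two[OF that] by blast
  have finL: "finite L" using finB by (simp add: L_def)
  have sumB: "non_edges s A + 2 * (\<Sum>b\<in>B. non_nbrs s A b) \<le> non_edges s V"
    using non_edges_Un_ge[OF finB finA _ sig] sub by (simp add: B_def Un_absorb1)
  have "(\<Sum>b\<in>B. non_nbrs s A b) = (\<Sum>b\<in>B - L. non_nbrs s A b) + (\<Sum>b\<in>L. non_nbrs s A b)"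
    using finB by (intro sum.subset_diff) (auto simp: L_def)
  moreover have "(\<Sum>b\<in>B - L. non_nbrs s A b) \<ge> (\<Sum>b\<in>B - L. t)"
    using outer by (intro sum_mono) (auto simp: B_def)
  moreover have "(\<Sum>b\<in>L. non_nbrs s A b) \<ge> (\<Sum>b\<in>L. card A - 1)"
  proof (intro sum_mono)
    fix b assume "b \<in> L"
    then have "b \<in> B" "card (d b) \<le> 1" by (auto simp: L_def)
    then show "card A - 1 \<le> non_nbrs s A b" using degree[of b] by linarith
  qed
  ultimately have sumL: "card (B - L) * t + card L * (card A - 1) \<le> (\<Sum>b\<in>B. non_nbrs s A b)"
    by simp
  have cardB: "card B = card (B - L) + card L"
  proof -
    have "L \<subseteq> B" by (auto simp: L_def)
    then show ?thesis using card_Diff_subset[OF finL] card_mono[OF finB] by fastforce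
  qed
  \<comment> \<open>Three such vertices would miss at least \<open>6 * (card A - 1)\<close> ordered
    pairs, beyond the budget because \<open>card A\<close> is at least \<open>card V - 10\<close>
    and \<open>card V\<close> at least \<open>40\<close>.\<close>
  have "card L \<le> 2"
  proof (rule ccontr)
    assume "\<not> card L \<le> 2"
    then have "3 * (card A - 1) \<le> card L * (card A - 1)" by (intro mult_le_mono1) simp
    then have "6 * (card A - 1) + 12 \<le> 4 * card V" using sumL sumB few by linarith
    then show False using V by linarith
  qed
  then consider "card L = 2" | "card L \<le> 1" by linarith
  then show ?thesis
  proof cases
    case 1
    \<comment> \<open>Every further outside vertex costs at least six ordered pairs while raising
      the budget by only four, and the two vertices of \<open>L\<close> already use all of
      it.\<close>
    have "card (B - L) * 3 \<le> card (B - L) * t" using t by (rule mult_le_mono2)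
    moreover have "card (B - L) * t + 2 * (card A - 1) \<le> (\<Sum>b\<in>B. non_nbrs s A b)"
      using sumL 1 by simp
    ultimately have "card (B - L) = 0" using sumB few 1 cardV cardB V by linarith
    then have BL: "B = L" using finB by (auto simp: L_def)
    obtain b c where bc: "B = {b, c}" "b \<noteq> c" using 1 BL by (auto simp: card_2_iff)
    have Veq: "V = insert c (insert b A)" using bc sub by (auto simp: B_def)
    have nA: "b \<notin> A" "c \<notin> A" using bc by (auto simp: B_def)
    have "non_edges s V = non_edges s A + 2 * non_nbrs s A b + 2 * non_nbrs s (insert b A) c"
      using non_edges_insert[of A b s] non_edges_insert[of "insert b A" c s] nA bc finA sig Veq by simp
    moreover have "non_nbrs s A b \<ge> card A - 1" "non_nbrs s A c \<ge> card A - 1"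
    proof -
      have "b \<in> L" "c \<in> L" using BL bc by auto
      then have "card (d b) \<le> 1" "card (d c) \<le> 1" by (simp_all add: L_def)
      then show "non_nbrs s A b \<ge> card A - 1" "non_nbrs s A c \<ge> card A - 1"
        using degree[of b] degree[of c] bc by auto
    qed
    moreover have "non_nbrs s A c \<le> non_nbrs s (insert b A) c"
      using finA by (intro non_nbrs_mono) auto
    moreover have "card V = card A + 2" using cardV bc by simp
    \<comment> \<open>With \<open>card V = card A + 2\<close> the budget is exactly
      \<open>4 * (card A - 1)\<close>, so all the estimates are equalities. The last one says that
      \<open>b\<close> is not a non-neighbour of \<open>c\<close>.\<close>
    ultimately have eqs: "non_edges s A = 0" "non_nbrs s A b = card A - 1" "non_nbrs s A c = card A - 1"
      "non_nbrs s (insert b A) c = non_nbrs s A c"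
      using few by linarith+
    have "s b c \<noteq> 0"
    proof
      assume "s b c = 0"
      then have "{u \<in> insert b A. u \<noteq> c \<and> s u c = 0} = insert b {u \<in> A. u \<noteq> c \<and> s u c = 0}"
        using bc by auto
      then have "non_nbrs s (insert b A) c = Suc (non_nbrs s A c)"
        using nA finA by (simp add: non_nbrs_def)
      then show False using eqs by simp
    qed
    have "card (d b) = 1" "card (d c) = 1"
      using degree[of b] degree[of c] eqs bc V by auto
    then obtain x y where xy: "d b = {x}" "d c = {y}" by (auto simp: card_1_singleton_iff)
    have "finite {(u, v). u \<in> A \<and> v \<in> A \<and> u \<noteq> v \<and> s u v = 0}"
      using finA by (rule finite_non_edges)
    then have "{(u, v). u \<in> A \<and> v \<in> A \<and> u \<noteq> v \<and> s u v = 0} = {}"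
      using eqs(1) by (simp add: non_edges_def)
    then have complete: "s u v = 1" if "u \<in> A" "v \<in> A" "u \<noteq> v" for u v
      using that pos[of u v] vals[of u v] sub by auto
    have neg: "s b c = -1"
    proof (rule ccontr)
      assume "s b c \<noteq> -1"
      then have bc0: "s b c \<ge> 0" using vals[of b c] by auto
      have "s u v \<ge> 0" if "u \<in> V" "v \<in> V" for u v
      proof (cases "u \<in> A \<or> v \<in> A")
        case True
        then show ?thesis using that pos[of u v] pos[of v u] sym[of u v] by auto
      next
        case False
        then have "u = b \<or> u = c" "v = b \<or> v = c" using that Veq by auto
        then show ?thesis using bc0 irrefl sym[of c b] by auto
      qed
      then have "balanced_on V s"
        unfolding balanced_on_def by (intro exI[of _ "\<lambda>_. 1"]) (simp add: signing_def switched_def)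
      then show False using unbal by simp
    qed
    \<comment> \<open>Distinct attachment vertices would let \<open>edge\<close> exclude the
      negative edge \<open>b c\<close>.\<close>
    then have "x = y" using edge[of b c x y] xy bc by auto
    have "s x b = 1" "s x c = 1" "x \<in> A"
      using d1[of x b] d1[of x c] dA[of x b] xy bc \<open>x = y\<close> by auto
    moreover have "\<forall>u\<in>A - {x}. s u b = 0 \<and> s u c = 0"
      using xy \<open>x = y\<close> unfolding d_def by blast
    ultimately show ?thesis
      using Veq nA bc neg complete by (intro exI[of _ x] exI[of _ b] exI[of _ c]) (simp add: insert_commute)
  next
    case 2
    have "balanced_on V s"
    proof (cases "\<forall>u\<in>B. \<forall>v\<in>B. s u v \<ge> 0")
      case True
      then have "s u v \<ge> 0" if "u \<in> V" "v \<in> V" for u v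
        using that pos[of u v] pos[of v u] sym[of u v] by (auto simp: B_def)
      then show ?thesis
        unfolding balanced_on_def by (intro exI[of _ "\<lambda>_. 1"]) (simp add: signing_def switched_def)
    next
      case False
      then obtain x y where xy: "x \<in> B" "y \<in> B" "s x y < 0" by auto
      then have "x \<noteq> y" using irrefl by auto
      \<comment> \<open>A negative edge outside the core has exactly one end in \<open>L\<close>:
        two ends exceed \<open>card L\<close>, and no ends contradicts \<open>edge2\<close>.\<close>
      have "\<not> (x \<in> L \<and> y \<in> L)"
      proof
        assume "x \<in> L \<and> y \<in> L"
        then have "card {x, y} \<le> card L" using finL by (intro card_mono) auto
        then show False using 2 \<open>x \<noteq> y\<close> by simp
      qed
      moreover have "\<not> (x \<notin> L \<and> y \<notin> L)" using edge2[of x y] Lempty[of y] xy by auto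
      ultimately obtain b c where bc: "b \<in> L" "c \<in> B - L" "s c b < 0"
        using xy sym[of x y] by (metis DiffI)
      then have b: "b \<in> B" by (simp add: L_def)
      \<comment> \<open>A core neighbour of \<open>b\<close> would make \<open>edge2\<close>
        applicable to the negative edge \<open>c b\<close>.\<close>
      have db: "d b = {}" using edge2[of c b] bc b by auto
      have "card L = 1"
      proof -
        have "card L > 0" using bc finL card_gt_0_iff by blast
        then show ?thesis using 2 by linarith
      qed
      then have Lb: "L = {b}" using bc by (auto simp: card_1_singleton_iff)
      have cb: "s c b = -1" using bc vals[of c b] by auto
      \<comment> \<open>A positive edge \<open>b v\<close> would make the three-vertex ear
        \<open>y, c, b, v, z\<close> negative. Thus no edge at \<open>b\<close> is positive, and
        switching at \<open>b\<close> alone removes every negative sign.\<close>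
      have nonpos: "s v b \<le> 0" if v: "v \<in> V" for v
      proof (cases "v \<in> B - {b, c}")
        case True
        obtain y where y: "y \<in> d c" using Lempty[of c] bc by auto
        obtain z where z: "z \<in> d v" "z \<noteq> y" using two[of v y] True Lb by auto
        have "s y (hd [c, b, v]) * walk_sign s [c, b, v] * s (last [c, b, v]) z \<noteq> -1"
          using True z y bc b dA posA Lb by (intro ear_positive) (auto simp: B_def)
        moreover have "s y c = 1" "s z v = 1" using d1 y z bc True by auto
        ultimately have "s b v \<noteq> 1" using cb sym[of v z] by auto
        then show ?thesis using vals[of v b] sym[of b v] by auto
      next
        case False
        then have "v = b \<or> v = c \<or> v \<in> A" using v by (auto simp: B_def)
        then show ?thesis using irrefl cb db by (auto simp: d_def)
      qed
      define e :: "'a \<Rightarrow> int" where "e v = (if v = b then -1 else 1)" for v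
      have "switched e s u v \<ge> 0" if uv: "u \<in> V" "v \<in> V" for u v
      proof (cases "u = b \<or> v = b")
        case True
        then show ?thesis
          using nonpos[OF uv(1)] nonpos[OF uv(2)] sym[of b u] sym[of b v] irrefl
          by (auto simp: switched_def e_def)
      next
        case False
        then have "s u v \<ge> 0"
          using pos[of u v] pos[of v u] sym[of u v] edge2[of u v] Lempty[of v] uv Lb
          by (cases "u \<in> A"; cases "v \<in> A") (auto simp: B_def)
        then show ?thesis using False by (simp add: switched_def e_def)
      qed
      moreover have "signing e" by (simp add: signing_def e_def)
      ultimately show ?thesis unfolding balanced_on_def by blast
    qed
    then show ?thesis using unbal by simp
  qed
qed

end

lemma unbalanced_dense_structure:
  assumes "signature s" "finite V" "3 \<le> k" "10 * k + 10 \<le> card V"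
    and "no_neg_cycle (2 * k + 1) V s" "non_edges s V + 12 \<le> 4 * card V" "\<not> balanced_on V s"
  shows "\<exists>e A a b c. signing e \<and> V = insert b (insert c A) \<and> a \<in> A \<and> b \<notin> A \<and> c \<notin> A \<and> b \<noteq> c
    \<and> switched e s b c = -1 \<and> switched e s a b = 1 \<and> switched e s a c = 1
    \<and> (\<forall>u\<in>A. \<forall>v\<in>A. u \<noteq> v \<longrightarrow> switched e s u v = 1) \<and> (\<forall>u\<in>A - {a}. s u b = 0 \<and> s u c = 0)"
proof -
  \<comment> \<open>Since \<open>card V\<close> is at least \<open>40\<close>, this \<open>t\<close>
    is small enough for \<open>room\<close> and \<open>room3\<close>, yet large enough that eleven
    outside vertices would cost \<open>22 * t\<close> ordered pairs, more than the budget.\<close>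
  define t where "t = card V div 5"
  obtain A where A: "A \<subseteq> V" "\<And>v. v \<in> A \<Longrightarrow> non_nbrs s A v \<le> t"
    "\<And>b. b \<in> V - A \<Longrightarrow> t \<le> non_nbrs s A b" "2 * t * card (V - A) \<le> non_edges s V"
    using ex_core[OF assms(2,1)] by blast
  have t: "5 * t \<le> card V" "card V \<le> 5 * t + 4" unfolding t_def by auto
  have "card (V - A) \<le> 10"
  proof (rule ccontr)
    assume "\<not> card (V - A) \<le> 10"
    then have "2 * t * 11 \<le> 2 * t * card (V - A)" by (intro mult_le_mono2) simp
    then show False using A(4) assms(3,4,6) t by linarith
  qed
  moreover have "card (V - A) = card V - card A" "card A \<le> card V"
    using A(1) assms(2) finite_subset by (auto intro: card_Diff_subset card_mono)
  ultimately have big: "card V \<le> card A + 10" by linarith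
  interpret dense_core V A s t k
    using assms A t big by unfold_locales auto
  obtain e where e: "signing e" "\<forall>u\<in>A. \<forall>v\<in>A. switched e s u v \<ge> 0"
    using core_balanced unfolding balanced_on_def by blast
  interpret e: dense_core V A "switched e s" t k
    using e(1) by (rule dense_core_switched)
  obtain f where f: "signing f" "\<forall>u\<in>A. \<forall>v\<in>V. switched f (switched e s) u v \<ge> 0"
    using e.ex_switching_positive_at_core e(2) by blast
  interpret f: dense_core V A "switched f (switched e s)" t k
    using f(1) by (rule e.dense_core_switched)
  \<comment> \<open>The first switching makes the core positive, the second the edges leaving it;
    \<open>g\<close> is their composite.\<close>
  define g where "g = (\<lambda>v. f v * e v)"
  have g: "signing g" unfolding g_def using f(1) e(1) by (rule signing_mult)
  have fg: "switched f (switched e s) = switched g s"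
    by (simp add: switched_switched g_def)
  have "\<exists>a b c. V = insert b (insert c A) \<and> a \<in> A \<and> b \<notin> A \<and> c \<notin> A \<and> b \<noteq> c
    \<and> switched g s b c = -1 \<and> switched g s a b = 1 \<and> switched g s a c = 1
    \<and> (\<forall>u\<in>A. \<forall>v\<in>A. u \<noteq> v \<longrightarrow> switched g s u v = 1)
    \<and> (\<forall>u\<in>A - {a}. switched g s u b = 0 \<and> switched g s u c = 0)"
  proof (rule f.extremal_structure[unfolded fg])
    show "\<not> balanced_on V (switched g s)"
      using balanced_on_switchedD[OF g] assms(7) by blast
  qed (use f(2) fg A(3) t big assms g in \<open>auto simp: non_nbrs_switched non_edges_switched\<close>)
  then show ?thesis
    unfolding switched_eq_0_iff[OF g] using g by blast
qed

section \<open>Transfer to signed graphs\<close>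

text \<open>Links the two encodings: the arbitrary signs off the edge set become
  \<open>0\<close>.\<close>

definition edge_sign :: "'a sgraph \<Rightarrow> 'a \<Rightarrow> 'a \<Rightarrow> int" where
  "edge_sign G u v = (if {u, v} \<in> edges G then sign G {u, v} else 0)"

lemma edgeD:
  assumes "signed_graph G" "e \<in> edges G"
  obtains u v where "e = {u, v}" "u \<noteq> v" "u \<in> verts G" "v \<in> verts G"
proof -
  have "e \<subseteq> verts G" "card e = 2"
    using assms unfolding signed_graph_def by auto
  then show ?thesis using that by (auto simp: card_2_iff)
qed

lemma signature_edge_sign:
  assumes "signed_graph G"
  shows "signature (edge_sign G)"
proof -
  have "edge_sign G u u = 0" for u
    using edgeD[OF assms, of "{u, u}"] by (auto simp: edge_sign_def)
  moreover have "edge_sign G u v \<in> {-1, 0, 1}" for u v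
    using assms by (auto simp: edge_sign_def signed_graph_def)
  moreover have "edge_sign G u v = edge_sign G v u" for u v
    by (simp add: edge_sign_def insert_commute)
  ultimately show ?thesis unfolding signature_def by blast
qed

lemma edge_sign_eq_0_iff: "signed_graph G \<Longrightarrow> edge_sign G u v = 0 \<longleftrightarrow> {u, v} \<notin> edges G"
  by (force simp: edge_sign_def signed_graph_def)

lemma finite_edges:
  assumes "signed_graph G"
  shows "finite (edges G)"
proof (rule finite_subset)
  show "edges G \<subseteq> Pow (verts G)" using assms by (auto simp: signed_graph_def)
  show "finite (Pow (verts G))" using assms by (simp add: signed_graph_def)
qed

lemma card_ordered_pairs:
  assumes "finite E" "\<And>e. e \<in> E \<Longrightarrow> card e = 2"
  shows "finite {(u, v). {u, v} \<in> E} \<and> card {(u, v). {u, v} \<in> E} = 2 * card E"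
  using assms
proof (induction E rule: finite_induct)
  case (insert e E)
  obtain x y where e: "e = {x, y}" "x \<noteq> y"
    using insert.prems[of e] by (auto simp: card_2_iff)
  have "{(u, v). {u, v} \<in> insert e E} = {(x, y), (y, x)} \<union> {(u, v). {u, v} \<in> E}"
    using e by (auto simp: doubleton_eq_iff)
  moreover have "{(x, y), (y, x)} \<inter> {(u, v). {u, v} \<in> E} = {}"
    using e insert.hyps by (auto simp: insert_commute)
  moreover have "card {(x, y), (y, x)} = 2" using e by simp
  moreover have IH: "finite {(u, v). {u, v} \<in> E}" "card {(u, v). {u, v} \<in> E} = 2 * card E"
    using insert by auto
  moreover have "card (insert e E) = card E + 1" using insert.hyps by simp
  ultimately show ?case using card_Un_disjoint[OF _ IH(1), of "{(x, y), (y, x)}"] by simp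
qed simp

text \<open>The square of the vertex set splits into missing pairs, adjacent pairs (two per edge)
  and the diagonal.\<close>

lemma non_edges_edge_sign:
  assumes "signed_graph G"
  shows "non_edges (edge_sign G) (verts G) + 2 * card (edges G) + card (verts G) = card (verts G) * card (verts G)"
proof -
  let ?V = "verts G" and ?P = "{(u, v). {u, v} \<in> edges G}"
  let ?N = "{(u, v). u \<in> ?V \<and> v \<in> ?V \<and> u \<noteq> v \<and> edge_sign G u v = 0}"
  have fin: "finite ?V" using assms by (simp add: signed_graph_def)
  have P: "finite ?P \<and> card ?P = 2 * card (edges G)"
    using assms by (intro card_ordered_pairs finite_edges) (auto simp: signed_graph_def)
  have inP: "u \<in> ?V \<and> v \<in> ?V \<and> u \<noteq> v" if "{u, v} \<in> edges G" for u v
    using edgeD[OF assms that] by (auto simp: doubleton_eq_iff)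
  have "?V \<times> ?V = ?N \<union> (?P \<union> (\<lambda>v. (v, v)) ` ?V)"
    using inP by (auto simp: edge_sign_eq_0_iff[OF assms])
  then have "card (?V \<times> ?V) = card (?N \<union> (?P \<union> (\<lambda>v. (v, v)) ` ?V))" by (rule arg_cong)
  also have "\<dots> = card ?N + card (?P \<union> (\<lambda>v. (v, v)) ` ?V)"
    using P fin inP by (intro card_Un_disjoint finite_non_edges) (auto simp: edge_sign_eq_0_iff[OF assms])
  also have "card (?P \<union> (\<lambda>v. (v, v)) ` ?V) = card ?P + card ((\<lambda>v. (v, v)) ` ?V)"
    using P fin inP by (intro card_Un_disjoint) auto
  also have "card ((\<lambda>v. (v, v)) ` ?V) = card ?V" by (intro card_image inj_onI) auto
  finally show ?thesis using P by (simp add: non_edges_def card_cartesian_product)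
qed

section \<open>Cycles as vertex lists and as subgraphs\<close>

lemma walk_sign_eq_prod:
  "walk_sign s vs = (\<Prod>i<length vs - 1. s (vs ! i) (vs ! Suc i))"
proof (induction s vs rule: walk_sign.induct)
  case (1 s x y xs)
  then show ?case by (simp add: prod.lessThan_Suc_shift del: prod.lessThan_Suc)
qed auto

text \<open>The closing edge is the factor at the last index, whose cyclic successor is
  \<open>0\<close>; this matches the indexing in \<open>cycle_edges\<close>.\<close>

lemma cycle_sign_eq_prod:
  assumes "vs \<noteq> []"
  shows "walk_sign s vs * s (last vs) (hd vs) =
    (\<Prod>i<length vs. s (vs ! i) (vs ! (Suc i mod length vs)))"
proof -
  obtain m where m: "length vs = Suc m" using assms by (cases vs) auto
  have "(\<Prod>i<length vs. s (vs ! i) (vs ! (Suc i mod length vs))) =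
      (\<Prod>i<m. s (vs ! i) (vs ! (Suc i mod length vs))) * s (vs ! m) (vs ! 0)"
    by (simp add: m)
  also have "(\<Prod>i<m. s (vs ! i) (vs ! (Suc i mod length vs))) = walk_sign s vs"
    by (simp add: walk_sign_eq_prod m)
  finally show ?thesis using assms m by (auto simp: last_conv_nth hd_conv_nth)
qed

lemma switch_empty: "switch {} G = G"
  by (simp add: switch_def)

lemma isomorphic_refl: "isomorphic G G"
  unfolding isomorphic_def by (intro exI[of _ id]) auto

text \<open>Two different indices with the same edge would be cyclic successors of each other,
  impossible for length at least three. This turns a product over indices into a product over the
  edge set.\<close>

lemma inj_on_cycle_edges:
  assumes "distinct vs" "3 \<le> length vs"
  shows "inj_on (\<lambda>i. {vs ! i, vs ! (Suc i mod length vs)}) {..<length vs}"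
proof (rule inj_onI)
  fix i j
  assume ij: "i \<in> {..<length vs}" "j \<in> {..<length vs}"
    and eq: "{vs ! i, vs ! (Suc i mod length vs)} = {vs ! j, vs ! (Suc j mod length vs)}"
  have "Suc i mod length vs < length vs" "Suc j mod length vs < length vs"
    using ij by (auto intro: mod_less_divisor)
  then have "i = j \<or> i = Suc j mod length vs \<and> Suc i mod length vs = j"
    using eq ij assms(1) by (auto simp: doubleton_eq_iff nth_eq_iff_index_eq)
  then show "i = j"
    using ij assms(2) by (auto simp: mod_Suc split: if_splits)
qed

text \<open>A list with product \<open>-1\<close> has no zero factor, so its cyclic pairs are edges.
  They form a subgraph \<open>C\<close> that is itself a negative cycle, and the trivial switching
  suffices.\<close>

lemma no_neg_cycle_edge_sign:
  assumes G: "signed_graph G" and free: "negative_cycle_free l G" and l: "3 \<le> l"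
  shows "no_neg_cycle l (verts G) (edge_sign G)"
  unfolding no_neg_cycle_def
proof (intro allI impI notI)
  fix vs assume vs: "distinct vs \<and> set vs \<subseteq> verts G \<and> length vs = l"
    and neg: "walk_sign (edge_sign G) vs * edge_sign G (last vs) (hd vs) = -1"
  let ?f = "\<lambda>i. {vs ! i, vs ! (Suc i mod length vs)}"
  have "vs \<noteq> []" using vs l by auto
  then have prod: "(\<Prod>i<length vs. edge_sign G (vs ! i) (vs ! (Suc i mod length vs))) = -1"
    using neg cycle_sign_eq_prod[of vs "edge_sign G"] by simp
  have nz: "edge_sign G (vs ! i) (vs ! (Suc i mod length vs)) \<noteq> 0" if "i < length vs" for i
  proof
    assume "edge_sign G (vs ! i) (vs ! (Suc i mod length vs)) = 0"
    then have "(\<Prod>i<length vs. edge_sign G (vs ! i) (vs ! (Suc i mod length vs))) = 0"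
      using that by (intro prod_zero) auto
    then show False using prod by simp
  qed
  then have in_edges: "?f i \<in> edges G" if "i < length vs" for i
    using that edge_sign_eq_0_iff[OF G] by blast
  have img: "cycle_edges vs = ?f ` {..<length vs}"
    unfolding cycle_edges_def by auto
  have "(\<Prod>e\<in>cycle_edges vs. sign G e) = (\<Prod>i<length vs. sign G (?f i))"
    unfolding img using vs l inj_on_cycle_edges[of vs] by (subst prod.reindex) auto
  also have "\<dots> = -1"
    unfolding prod[symmetric] using in_edges by (intro prod.cong) (auto simp: edge_sign_def)
  finally have sign: "(\<Prod>e\<in>cycle_edges vs. sign G e) = -1" .
  define C where "C = \<lparr>verts = set vs, edges = cycle_edges vs, sign = sign G\<rparr>"
  have sub: "cycle_edges vs \<subseteq> edges G" unfolding img using in_edges by auto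
  have "cycle_edges vs \<subseteq> {e. e \<subseteq> set vs}"
    unfolding img using \<open>vs \<noteq> []\<close> by (auto intro!: nth_mem)
  then have C: "signed_graph C"
    using G sub unfolding signed_graph_def C_def by auto
  then have "subgraph C G"
    using vs sub by (simp add: subgraph_def C_def)
  moreover have "negative_cycle l C"
    using C sign vs l unfolding negative_cycle_def C_def by auto
  moreover have "switching_equivalent C C"
    unfolding switching_equivalent_def using isomorphic_refl[of C] switch_empty[of C] by auto
  ultimately show False using free unfolding negative_cycle_free_def by blast
qed

section \<open>Signings realised by \<open>switch\<close>\<close>

text \<open>Both ends lie in \<open>verts G\<close>, so \<open>switch\<close> flips the edge exactly
  when \<open>e\<close> takes different values at them.\<close>

lemma sign_switch:
  assumes "signed_graph G" "signing e" "{u, v} \<in> edges G"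
  shows "sign (switch {v \<in> verts G. e v = -1} G) {u, v} = switched e (edge_sign G) u v"
proof -
  have "u \<in> verts G" "v \<in> verts G"
    using edgeD[OF assms(1,3)] by (auto simp: doubleton_eq_iff)
  then show ?thesis
    using assms(3) signing_values[OF assms(2), of u] signing_values[OF assms(2), of v]
    by (auto simp: switch_def switched_def edge_sign_def)
qed

lemma balanced_if_balanced_on:
  assumes G: "signed_graph G" and bal: "balanced_on (verts G) (edge_sign G)"
  shows "balanced G"
proof -
  obtain e where e: "signing e"
    and pos: "\<And>u v. u \<in> verts G \<Longrightarrow> v \<in> verts G \<Longrightarrow> switched e (edge_sign G) u v \<ge> 0"
    using bal unfolding balanced_on_def by blast
  define U where "U = {v \<in> verts G. e v = -1}"
  have one: "sign (switch U G) x = 1" if x: "x \<in> edges G" for x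
  proof -
    obtain u v where uv: "x = {u, v}" "u \<in> verts G" "v \<in> verts G"
      using edgeD[OF G x] by blast
    have "switched e (edge_sign G) u v \<noteq> 0"
      using switched_eq_0_iff[OF e] edge_sign_eq_0_iff[OF G] x uv by simp
    then have "switched e (edge_sign G) u v = 1"
      using pos[OF uv(2,3)] signature_values[OF signature_switched[OF e signature_edge_sign[OF G]], of u v]
      by auto
    then show ?thesis using sign_switch[OF G e] x uv unfolding U_def by simp
  qed
  have sel: "edges (switch U G) = edges G" "verts (switch U G) = verts G" by (simp_all add: switch_def)
  have "signed_graph (switch U G)"
    using G one unfolding signed_graph_def sel by simp
  moreover have "switching_equivalent G (switch U G)"
    unfolding switching_equivalent_def
    by (intro exI[of _ U] conjI isomorphic_refl) (auto simp: U_def)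
  ultimately show ?thesis
    unfolding balanced_def using one sel by metis
qed

section \<open>The extremal graph\<close>

lemma card_edges_neg_triangle_dot_complete:
  assumes "3 \<le> n"
  shows "real (card (edges (neg_triangle_dot_complete n))) = real n * (real n - 1) / 2 - 2 * (real n - 3)"
proof -
  let ?K = "{e. e \<subseteq> {2..<n} \<and> card e = 2}"
  have "card ?K = (n - 2) choose 2"
    using n_subsets[of "{2..<n}" 2] by simp
  moreover have "finite ?K" by (rule finite_subset[of _ "Pow {2..<n}"]) auto
  moreover have "card ({{0, 1}, {0, 2}, {1, 2}} \<union> ?K) = card {{0, 1}, {0, 2}, {1, 2 :: nat}} + card ?K"
    using \<open>finite ?K\<close> by (intro card_Un_disjoint) auto
  moreover have "card {{0, 1}, {0, 2}, {1, 2 :: nat}} = 3"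
    by (simp add: doubleton_eq_iff)
  ultimately have "card (edges (neg_triangle_dot_complete n)) = 3 + ((n - 2) choose 2)"
    by (simp add: neg_triangle_dot_complete_def)
  moreover have "real ((n - 2) choose 2) = (real n - 2) * (real n - 3) / 2"
  proof -
    obtain m where m: "n = m + 3" using assms le_Suc_ex by (metis add.commute)
    \<comment> \<open>Makes the natural-number division by two in \<open>choose_two\<close>
      exact.\<close>
    have "even ((m + 1) * m)" by simp
    then show ?thesis unfolding m choose_two by (simp add: real_of_nat_div field_simps)
  qed
  ultimately show ?thesis by (simp add: field_simps)
qed

text \<open>Switching keeps the edge set, and a bijection of vertices is injective on sets of
  vertices.\<close>

lemma card_edges_switching_equivalent:
  assumes "signed_graph G" "switching_equivalent G H"
  shows "card (edges G) = card (edges H)"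
proof -
  obtain U f where f: "bij_betw f (verts G) (verts H)" "edges H = (\<lambda>e. f ` e) ` edges G"
    using assms(2) unfolding switching_equivalent_def isomorphic_def by (auto simp: switch_def)
  have "inj_on (\<lambda>e. f ` e) (Pow (verts G))"
    using f(1) by (intro inj_on_image_Pow) (simp add: bij_betw_def)
  moreover have "edges G \<subseteq> Pow (verts G)"
    using assms(1) by (auto simp: signed_graph_def)
  ultimately show ?thesis
    unfolding f(2) by (metis card_image inj_on_subset)
qed

lemma switching_equivalent_extremal:
  assumes G: "signed_graph G" and e: "signing e"
    and V: "verts G = insert b (insert c A)" and A: "a \<in> A" "b \<notin> A" "c \<notin> A" "b \<noteq> c"
    and s: "switched e (edge_sign G) b c = -1" "switched e (edge_sign G) a b = 1"
      "switched e (edge_sign G) a c = 1"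
    and sA: "\<And>u v. u \<in> A \<Longrightarrow> v \<in> A \<Longrightarrow> u \<noteq> v \<Longrightarrow> switched e (edge_sign G) u v = 1"
    and sO: "\<And>u. u \<in> A - {a} \<Longrightarrow> edge_sign G u b = 0 \<and> edge_sign G u c = 0"
  shows "switching_equivalent G (neg_triangle_dot_complete (card (verts G)))"
proof -
  define n where "n = card (verts G)"
  have finA: "finite A" using G V by (simp add: signed_graph_def)
  have n: "n = card A + 2" using V A finA by (simp add: n_def)
  have "card A > 0" using A finA by (auto simp: card_gt_0_iff)
  then have "card (A - {a}) = card {3..<n}" using A finA n by simp
  then obtain h where h: "bij_betw h (A - {a}) {3..<n}"
    using finite_same_card_bij[of "A - {a}" "{3..<n}"] finA by auto
  \<comment> \<open>The negative edge \<open>b c\<close> goes to \<open>{0, 1}\<close>, the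
    attachment vertex \<open>a\<close> to \<open>2\<close>, and the rest of the core to
    \<open>{3..<n}\<close>.\<close>
  define f where "f v = (if v = b then 0 else if v = c then 1 else if v = a then 2 else h v)" for v
  have abc: "a \<noteq> b" "a \<noteq> c" using A by auto
  have f: "f b = 0" "f c = 1" "f a = 2" using A abc by (auto simp: f_def)
  have "bij_betw f (A - {a}) {3..<n}"
    using h A by (subst bij_betw_cong[of _ _ h]) (auto simp: f_def)
  then have "bij_betw f (A - {a} \<union> {a}) ({3..<n} \<union> {f a})"
    using f by (intro notIn_Un_bij_betw) auto
  moreover have "A - {a} \<union> {a} = A" "{3..<n} \<union> {f a} = {2..<n}"
    using A f n \<open>card A > 0\<close> by auto
  ultimately have fA: "bij_betw f A {2..<n}" by simp
  have "bij_betw f (A \<union> {c}) ({2..<n} \<union> {f c})"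
    using f A by (intro notIn_Un_bij_betw fA) auto
  then have "bij_betw f (A \<union> {c} \<union> {b}) ({2..<n} \<union> {f c} \<union> {f b})"
    using f A by (intro notIn_Un_bij_betw[of b "A \<union> {c}" f "{2..<n} \<union> {f c}"]) simp_all
  moreover have "A \<union> {c} \<union> {b} = verts G" "{2..<n} \<union> {f c} \<union> {f b} = {0..<n}"
    using V f n by auto
  ultimately have fV: "bij_betw f (verts G) {0..<n}" by simp
  let ?K = "{x. x \<subseteq> A \<and> card x = 2}"
  have edge_iff: "{u, v} \<in> edges G \<longleftrightarrow> switched e (edge_sign G) u v \<noteq> 0" for u v
    using switched_eq_0_iff[OF e] edge_sign_eq_0_iff[OF G] by blast
  have tri: "{b, c} \<in> edges G" "{a, b} \<in> edges G" "{a, c} \<in> edges G"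
    using s by (simp_all add: edge_iff)
  have K: "?K \<subseteq> edges G" using sA by (auto simp: card_2_iff edge_iff)
  have "x \<in> {{b, c}, {a, b}, {a, c}} \<union> ?K" if x: "x \<in> edges G" for x
  proof -
    obtain u v where uv: "x = {u, v}" "u \<noteq> v" "u \<in> verts G" "v \<in> verts G"
      using edgeD[OF G x] by blast
    have out: "{w, b} \<notin> edges G \<and> {w, c} \<notin> edges G" if "w \<in> A" "w \<noteq> a" for w
      using that sO edge_sign_eq_0_iff[OF G] by blast
    have "u \<in> A \<or> u = b \<or> u = c" "v \<in> A \<or> v = b \<or> v = c" using uv V by auto
    then consider "u \<in> A" "v \<in> A" | "u \<in> A" "v = b \<or> v = c" | "v \<in> A" "u = b \<or> u = c"
      | "{u, v} = {b, c}"
      using uv(2) by blast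
    then show ?thesis
    proof cases
      case 1
      then show ?thesis using uv by simp
    next
      case 2
      then have "u = a" using out[of u] uv x by blast
      then show ?thesis using 2 uv by blast
    next
      case 3
      then have "v = a" using out[of v] uv x by (metis insert_commute)
      then show ?thesis using 3 uv by (auto simp: insert_commute)
    next
      case 4
      then show ?thesis using uv by simp
    qed
  qed
  then have "edges G \<subseteq> {{b, c}, {a, b}, {a, c}} \<union> ?K" by (rule subsetI)
  moreover have "{{b, c}, {a, b}, {a, c}} \<union> ?K \<subseteq> edges G" using tri K by simp
  ultimately have E: "edges G = {{b, c}, {a, b}, {a, c}} \<union> ?K" by (rule equalityI)
  have imgK: "(\<lambda>x. f ` x) ` ?K = {x. x \<subseteq> {2..<n} \<and> card x = 2}"
  proof (intro equalityI subsetI)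
    fix y assume "y \<in> (\<lambda>x. f ` x) ` ?K"
    then obtain x where x: "y = f ` x" "x \<subseteq> A" "card x = 2" by blast
    then have "card y = 2" using fA card_image[of f x] inj_on_subset by (auto simp: bij_betw_def)
    then show "y \<in> {x. x \<subseteq> {2..<n} \<and> card x = 2}" using x fA by (auto simp: bij_betw_def)
  next
    fix y assume y: "y \<in> {x. x \<subseteq> {2..<n} \<and> card x = 2}"
    then obtain x where x: "x \<subseteq> A" "inj_on f x" "y = f ` x"
      using fA unfolding bij_betw_def by (metis (lifting) mem_Collect_eq subset_image_inj)
    then have "card x = 2" using y card_image[of f x] by simp
    then show "y \<in> (\<lambda>x. f ` x) ` ?K" using x by blast
  qed
  define U where "U = {v \<in> verts G. e v = -1}"
  have "sign (neg_triangle_dot_complete n) (f ` x) = sign (switch U G) x" if x: "x \<in> edges G" for x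
  proof -
    \<comment> \<open>The model is negative only on \<open>{0, 1}\<close>. Every edge other than
      \<open>b c\<close> has an end in \<open>A\<close>, which \<open>f\<close> sends to at least
      \<open>2\<close>, and is positive after switching.\<close>
    have "x = {b, c} \<or> (\<exists>u v. x = {u, v} \<and> u \<in> A \<and> switched e (edge_sign G) u v = 1)"
    proof -
      consider "x = {b, c}" | "x = {a, b}" | "x = {a, c}" | "x \<subseteq> A" "card x = 2"
        using x unfolding E by blast
      then show ?thesis
      proof cases
        case 4
        then obtain u v where "x = {u, v}" "u \<noteq> v" by (auto simp: card_2_iff)
        then show ?thesis using 4 sA[of u v] by blast
      qed (use s A in blast)+
    qed
    then show ?thesis
    proof
      assume "x = {b, c}"
      then show ?thesis
        using s sign_switch[OF G e tri(1)] f by (simp add: U_def neg_triangle_dot_complete_def)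
    next
      assume "\<exists>u v. x = {u, v} \<and> u \<in> A \<and> switched e (edge_sign G) u v = 1"
      then obtain u v where uv: "x = {u, v}" "u \<in> A" "switched e (edge_sign G) u v = 1" by blast
      then have "f u \<ge> 2" using fA by (auto simp: bij_betw_def)
      then have "f ` x \<noteq> {0, 1}" using uv by (auto simp: doubleton_eq_iff)
      then show ?thesis
        using uv x sign_switch[OF G e, of u v] by (simp add: U_def neg_triangle_dot_complete_def)
    qed
  qed
  moreover have "edges (neg_triangle_dot_complete n) = (\<lambda>x. f ` x) ` edges G"
    unfolding E image_Un imgK using f by (simp add: neg_triangle_dot_complete_def insert_commute)
  ultimately have "isomorphic (switch U G) (neg_triangle_dot_complete n)"
    unfolding isomorphic_def using fV
    by (intro exI[of _ f]) (simp add: switch_def neg_triangle_dot_complete_def)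
  moreover have "U \<subseteq> verts G" by (auto simp: U_def)
  ultimately show ?thesis
    unfolding switching_equivalent_def n_def by blast
qed

theorem theorem1p3:
  fixes G :: "'a sgraph" and n k :: nat
  assumes "signed_graph G"
    and "\<not> balanced G"
    and "card (verts G) = n"
    and "3 \<le> k"
    and "real k \<le> real n / 10 - 1"
    and "negative_cycle_free (2 * k + 1) G"
  shows "real (card (edges G)) \<le> real n * (real n - 1) / 2 - 2 * (real n - 3) \<and>
    (real (card (edges G)) = real n * (real n - 1) / 2 - 2 * (real n - 3) \<longleftrightarrow>
       switching_equivalent G (neg_triangle_dot_complete n))"
proof -
  let ?bound = "real n * (real n - 1) / 2 - 2 * (real n - 3)"
  let ?s = "edge_sign G"
  have n: "10 * k + 10 \<le> n" using assms(5) by linarith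
  have equal: "real (card (edges G)) = ?bound" if "switching_equivalent G (neg_triangle_dot_complete n)"
    using card_edges_switching_equivalent[OF assms(1) that] card_edges_neg_triangle_dot_complete[of n] n
    by simp
  \<comment> \<open>Reaching the bound already forces the extremal graph, which has exactly that
    many edges; this gives both the inequality and the equality case.\<close>
  have "switching_equivalent G (neg_triangle_dot_complete n)" if "real (card (edges G)) \<ge> ?bound"
  proof -
    have "real (non_edges ?s (verts G)) + 2 * real (card (edges G)) + real n = real n * real n"
      using non_edges_edge_sign[OF assms(1)] assms(3) by (metis of_nat_add of_nat_mult of_nat_numeral)
    \<comment> \<open>At most \<open>2 * n - 6\<close> missing edges, that is, at most
      \<open>4 * n - 12\<close> ordered pairs.\<close>
    then have "real (non_edges ?s (verts G)) + 12 \<le> 4 * real n"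
      using that by (simp add: field_simps)
    then have few: "non_edges ?s (verts G) + 12 \<le> 4 * card (verts G)"
      using assms(3) by linarith
    have "\<exists>e A a b c. signing e \<and> verts G = insert b (insert c A) \<and> a \<in> A \<and> b \<notin> A \<and> c \<notin> A \<and> b \<noteq> c
      \<and> switched e ?s b c = -1 \<and> switched e ?s a b = 1 \<and> switched e ?s a c = 1
      \<and> (\<forall>u\<in>A. \<forall>v\<in>A. u \<noteq> v \<longrightarrow> switched e ?s u v = 1) \<and> (\<forall>u\<in>A - {a}. ?s u b = 0 \<and> ?s u c = 0)"
    proof (rule unbalanced_dense_structure[OF _ _ assms(4) _ _ few])
      show "signature ?s" using assms(1) by (rule signature_edge_sign)
      show "finite (verts G)" using assms(1) by (simp add: signed_graph_def)
      show "10 * k + 10 \<le> card (verts G)" using n assms(3) by simp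
      show "no_neg_cycle (2 * k + 1) (verts G) ?s"
        using assms by (intro no_neg_cycle_edge_sign) auto
      show "\<not> balanced_on (verts G) ?s" using balanced_if_balanced_on[OF assms(1)] assms(2) by blast
    qed
    then obtain e A a b c where "signing e" "verts G = insert b (insert c A)" "a \<in> A" "b \<notin> A" "c \<notin> A"
      "b \<noteq> c" "switched e ?s b c = -1" "switched e ?s a b = 1" "switched e ?s a c = 1"
      "\<forall>u\<in>A. \<forall>v\<in>A. u \<noteq> v \<longrightarrow> switched e ?s u v = 1" "\<forall>u\<in>A - {a}. ?s u b = 0 \<and> ?s u c = 0"
      by blast
    then show ?thesis
      using switching_equivalent_extremal[OF assms(1), of e b c A a] assms(3) by blast
  qed
  then show ?thesis using equal by fastforce
qed

end
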